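(* Let $n\ge4$ and $0\le m\le\lfloor n/2\rfloor$. Then the coefficient $H^*_m$ of $t^m$ in the equivariant $H^*$-polynomial $H^*(\Delta_{2,n};S_n)[t]$ is a permutation character of $S_n$ if and only if $m\ne1$. Moreover, the trivial character does not appear in $H^*_1$ (it has multiplicity zero in $H^*_1$).
   Context: The second hypersimplex is $\Delta_{2,n}=\{x\in\mathbb R^n: 0\le x_i\le 1 \text{ for all } i,\ x_1+\dots+x_n=2\}$; $S_n$ acts on $\mathbb R^n$ by permuting coordinates and leaves $\Delta_{2,n}$ invariant. Equivariant $H^*$-series: for $d\ge 1$ let $\chi_d$ be the character of the permutation representation of $S_n$ on $d\Delta_{2,n}\cap\mathbb Z^n$, so $\chi_d(\sigma)=|\{x\in d\Delta_{2,n}\cap\mathbb Z^n:\sigma(x)=x\}|$; let $\chi_0$ be the trivial character. Let $\rho(\sigma)$ be the $n\times n$ permutation matrix of $\sigma$. Then $H^*(\Delta_{2,n};S_n)[t]=\sum_{m\ge0}H^*_mt^m$ is the power series with coefficients in the representation ring of $S_n$ (over $\mathbb C$, virtual representations identified with characters) defined by $\sum_{d\ge0}\chi_d(\sigma)t^d=\bigl(\sum_{m\ge0}H^*_m(\sigma)t^m\bigr)/\det(I_n-t\rho(\sigma))$ for all $\sigma\in S_n$. It is a polynomial in $t$. A permutation character of $S_n$ is the character $\sigma\mapsto|\{x\in X:\sigma(x)=x\}|$ of an action of $S_n$ on a finite set $X$. *)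

theory Defs
  imports
    "HOL-Computational_Algebra.Formal_Power_Series"
    "HOL-Algebra.Group_Action"
    "HOL-Algebra.Sym_Groups"
    "Jordan_Normal_Form.Determinant"
begin

section \<open>The second hypersimplex and the permutation action\<close>

text \<open>
  \<open>S\<^sub>n\<close> is the library group \<^term>\<open>sym_group n\<close> of permutations of \<open>{1..n}\<close>, while vectors and
  matrices are indexed from \<open>0\<close>: the coordinate \<open>x\<^sub>i\<close> of the mathematics is \<open>x $ (i - 1)\<close>.
\<close>

definition second_hypersimplex :: "nat \<Rightarrow> real vec set" where
  "second_hypersimplex n =
     {x \<in> carrier_vec n. (\<forall>i<n. 0 \<le> x $ i \<and> x $ i \<le> 1) \<and> (\<Sum>i<n. x $ i) = 2}"

definition dilate_lattice_points :: "nat \<Rightarrow> nat \<Rightarrow> real vec set" where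
  "dilate_lattice_points n d =
     (\<lambda>x. real d \<cdot>\<^sub>v x) ` second_hypersimplex n \<inter> {x \<in> carrier_vec n. \<forall>i<n. x $ i \<in> \<int>}"

text \<open>\<open>\<rho>(\<sigma>) e\<^sub>j = e\<^bsub>\<sigma>(j)\<^esub>\<close>, so that \<open>\<rho>\<close> is a homomorphism (a left action).\<close>

definition perm_mat :: "nat \<Rightarrow> (nat \<Rightarrow> nat) \<Rightarrow> 'a :: zero_neq_one mat" where
  "perm_mat n \<sigma> = mat n n (\<lambda>(i, j). if Suc i = \<sigma> (Suc j) then 1 else 0)"

definition ehrhart_char :: "nat \<Rightarrow> nat \<Rightarrow> (nat \<Rightarrow> nat) \<Rightarrow> complex" where
  "ehrhart_char n d \<sigma> =
     (if d = 0 then 1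
      else of_nat (card (invariants (dilate_lattice_points n d) (\<lambda>\<tau> x. perm_mat n \<tau> *\<^sub>v x) \<sigma>)))"


section \<open>The equivariant \<open>H\<^sup>*\<close>-series\<close>

definition ehrhart_series :: "nat \<Rightarrow> (nat \<Rightarrow> nat) \<Rightarrow> complex fps" where
  "ehrhart_series n \<sigma> = Abs_fps (\<lambda>d. ehrhart_char n d \<sigma>)"

definition det_series :: "nat \<Rightarrow> (nat \<Rightarrow> nat) \<Rightarrow> complex fps" where
  "det_series n \<sigma> = det (1\<^sub>m n - fps_X \<cdot>\<^sub>m perm_mat n \<sigma>)"

definition hstar_series :: "nat \<Rightarrow> (nat \<Rightarrow> nat) \<Rightarrow> complex fps" where
  "hstar_series n \<sigma> = (THE H. ehrhart_series n \<sigma> = H / det_series n \<sigma>)"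

definition hstar_coeff :: "nat \<Rightarrow> nat \<Rightarrow> (nat \<Rightarrow> nat) \<Rightarrow> complex" where
  "hstar_coeff n m \<sigma> = fps_nth (hstar_series n \<sigma>) m"

lemma det_series_nth_0: "fps_nth (det_series n \<sigma>) 0 = 1"
proof -
  interpret h: comm_ring_hom "\<lambda>f :: complex fps. fps_nth f 0"
    by unfold_locales auto
  have "map_mat (\<lambda>f. fps_nth f 0) (1\<^sub>m n - fps_X \<cdot>\<^sub>m perm_mat n \<sigma> :: complex fps mat) = 1\<^sub>m n"
    by (intro eq_matI) (auto simp: perm_mat_def)
  then show ?thesis
    unfolding det_series_def by (simp flip: h.hom_det)
qed

lemma det_series_nonzero: "det_series n \<sigma> \<noteq> 0"
  using det_series_nth_0[of n \<sigma>] by auto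

text \<open>The defining equation has exactly one solution.\<close>

lemma ehrhart_series_eq_divide_iff:
  "ehrhart_series n \<sigma> = H / det_series n \<sigma> \<longleftrightarrow> H = ehrhart_series n \<sigma> * det_series n \<sigma>"
proof -
  have "is_unit (det_series n \<sigma>)"
    using det_series_nth_0[of n \<sigma>] by (simp add: fps_is_unit_iff)
  then have "det_series n \<sigma> dvd H"
    by (rule unit_imp_dvd)
  then show ?thesis
    using det_series_nonzero[of n \<sigma>] by (auto simp: dvd_div_mult_self)
qed

lemma hstar_series_eq: "hstar_series n \<sigma> = ehrhart_series n \<sigma> * det_series n \<sigma>"
  unfolding hstar_series_def ehrhart_series_eq_divide_iff by simp

lemma ehrhart_series_eq_hstar_divide:
  "ehrhart_series n \<sigma> = hstar_series n \<sigma> / det_series n \<sigma>"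
  unfolding ehrhart_series_eq_divide_iff by (rule hstar_series_eq)


section \<open>Permutation characters and multiplicities\<close>

text \<open>
  The finite set acted upon is taken inside \<^typ>\<open>nat\<close>; this is no restriction, see
  \<open>is_permutation_characterI\<close> below.
\<close>

definition is_permutation_character :: "('a, 'b) monoid_scheme \<Rightarrow> ('a \<Rightarrow> complex) \<Rightarrow> bool" where
  "is_permutation_character G f \<longleftrightarrow>
     (\<exists>(X :: nat set) \<phi>. finite X \<and> group_action G X \<phi> \<and>
        (\<forall>g\<in>carrier G. f g = of_nat (card (invariants X \<phi> g))))"

lemma is_permutation_characterI:
  fixes X :: "'c set"
  assumes fin: "finite X" and act: "group_action G X \<phi>"
    and f: "\<And>g. g \<in> carrier G \<Longrightarrow> f g = of_nat (card (invariants X \<phi> g))"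
  shows "is_permutation_character G f"
proof -
  interpret A: group_action G X \<phi> by (rule act)
  interpret H: group_hom G "BijGroup X" \<phi> by (rule A.group_hom)
  obtain h :: "'c \<Rightarrow> nat" where inj: "inj_on h X"
    using finite_imp_inj_to_nat_seg[OF fin] by blast
  define k where "k = inv_into X h"
  have k: "k (h x) = x" if "x \<in> X" for x
    using inj that by (simp add: k_def)
  define Y where "Y = h ` X"
  define \<psi> where "\<psi> g = (\<lambda>y\<in>Y. h (\<phi> g (k y)))" for g
  have \<phi>_in: "\<phi> g x \<in> X" if "g \<in> carrier G" "x \<in> X" for g x
    using A.element_image[OF that] by blast
  have \<phi>_mult: "\<phi> (a \<otimes>\<^bsub>G\<^esub> b) x = \<phi> a (\<phi> b x)"
    if "a \<in> carrier G" "b \<in> carrier G" "x \<in> X" for a b x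
    using A.composition_rule[OF that(3,1,2)] .
  have \<phi>_bij: "bij_betw (\<phi> g) X X" if "g \<in> carrier G" for g
    using A.bij_prop0[OF that] by (simp add: Bij_def)
  have hb: "bij_betw h X Y" and kb: "bij_betw k Y X"
    using inj unfolding Y_def k_def
    by (auto simp: bij_betw_def inj_on_inv_into inv_into_image_cancel)
  have Bij: "\<psi> g \<in> Bij Y" if "g \<in> carrier G" for g
  proof -
    have "bij_betw (h \<circ> \<phi> g \<circ> k) Y Y"
      using bij_betw_trans[OF kb bij_betw_trans[OF \<phi>_bij[OF that] hb]] by (simp add: o_assoc)
    then have "bij_betw (\<psi> g) Y Y"
      by (rule iffD1[OF bij_betw_cong, rotated]) (simp add: \<psi>_def)
    then show ?thesis by (simp add: Bij_def \<psi>_def)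
  qed
  have "\<psi> \<in> hom G (BijGroup Y)"
  proof (rule homI)
    fix a b assume ab: "a \<in> carrier G" "b \<in> carrier G"
    have "\<psi> (a \<otimes>\<^bsub>G\<^esub> b) y = compose Y (\<psi> a) (\<psi> b) y" for y
    proof (cases "y \<in> Y")
      case True
      then obtain x where "x \<in> X" "y = h x" unfolding Y_def by blast
      with ab \<phi>_in True show ?thesis
        by (simp add: compose_def \<psi>_def k \<phi>_mult Y_def del: H.hom_mult)
    qed (simp add: compose_def \<psi>_def)
    then have "\<psi> (a \<otimes>\<^bsub>G\<^esub> b) = compose Y (\<psi> a) (\<psi> b)" ..
    then show "\<psi> (a \<otimes>\<^bsub>G\<^esub> b) = \<psi> a \<otimes>\<^bsub>BijGroup Y\<^esub> \<psi> b"
      using Bij ab by (simp add: BijGroup_def)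
  qed (use Bij in \<open>simp add: BijGroup_def\<close>)
  then have "group_action G Y \<psi>"
    using H.G.is_group
    by (simp add: group_action_def group_hom_def group_hom_axioms_def group_BijGroup)
  moreover have "card (invariants Y \<psi> g) = card (invariants X \<phi> g)" if "g \<in> carrier G" for g
  proof -
    have "invariants Y \<psi> g = h ` invariants X \<phi> g"
      using that \<phi>_in inj by (auto simp: invariants_def Y_def \<psi>_def k inj_on_eq_iff)
    moreover have "inj_on h (invariants X \<phi> g)"
      using inj by (rule inj_on_subset) (auto simp: invariants_def)
    ultimately show ?thesis by (simp add: card_image)
  qed
  ultimately show ?thesis
    unfolding is_permutation_character_def using fin f
    by (intro exI[of _ Y] exI[of _ \<psi>]) (auto simp: Y_def)
qed

text \<open>
  For an irreducible character \<open>\<chi>\<close>, \<open>character_inner G f \<chi>\<close> is the multiplicity of \<open>\<chi>\<close> in the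
  (possibly virtual) character \<open>f\<close>.
\<close>

definition character_inner ::
    "('a, 'b) monoid_scheme \<Rightarrow> ('a \<Rightarrow> complex) \<Rightarrow> ('a \<Rightarrow> complex) \<Rightarrow> complex" where
  "character_inner G f \<chi> = (\<Sum>g\<in>carrier G. f g * cnj (\<chi> g)) / of_nat (card (carrier G))"

definition trivial_character :: "'a \<Rightarrow> complex" where
  "trivial_character g = 1"

end

theory Submission
  imports Defs
begin

text \<open>
  Fix \<open>\<sigma> \<in> S\<^sub>n\<close> and write \<open>h\<^sub>k\<close> and \<open>e\<^sub>k\<close> for the numbers of \<open>\<sigma>\<close>-invariant multisets and
  subsets of size \<open>k\<close>. A lattice point of the \<open>d\<close>-th dilate is a multiset of size \<open>2d\<close> none of whose
  multiplicities exceeds \<open>d\<close>. An invariant multiset of size \<open>2d\<close> has at most one point of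
  multiplicity above \<open>d\<close>, which is then a fixed point of \<open>\<sigma>\<close>; removing \<open>d + 1\<close> copies of it leaves
  an arbitrary invariant multiset of size \<open>d - 1\<close>. Hence \<open>\<chi>\<^sub>d(\<sigma>) = h\<^bsub>2d\<^esub> - e\<^sub>1 h\<^bsub>d-1\<^esub>\<close>.

  Let \<open>D(t)\<close> be the determinant of \<open>1 - t\<rho>(\<sigma>)\<close>, and let \<open>P(t)\<close> and \<open>Q(t)\<close> be the generating functions
  of \<open>h\<close> and \<open>e\<close>. If \<open>l\<close> runs over the cycle lengths of \<open>\<sigma>\<close>, then \<open>D = \<Prod>(1 - t\<^sup>l)\<close>,
  \<open>P = 1 / D\<close> and \<open>Q = \<Prod>(1 + t\<^sup>l)\<close>. Therefore \<open>D(t\<^sup>2) P(t) = Q(t)\<close>, and taking even parts,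
  \<open>D(t) \<cdot> \<Sum>\<^sub>d h\<^bsub>2d\<^esub> t\<^sup>d = \<Sum>\<^sub>m e\<^bsub>2m\<^esub> t\<^sup>m\<close>. Multiplying the formula for \<open>\<chi>\<^sub>d\<close> by \<open>D\<close> gives
  \<open>H\<^sup>*\<^sub>m(\<sigma>) = e\<^bsub>2m\<^esub>\<close> for \<open>m \<noteq> 1\<close> and \<open>H\<^sup>*\<^sub>1(\<sigma>) = e\<^sub>2 - e\<^sub>1\<close> (lemma \<open>hstar_coeff_eq\<close>).

  So for \<open>m \<noteq> 1\<close> the coefficient is the permutation character on the \<open>2m\<close>-subsets of \<open>{1..n}\<close>.
  For \<open>m = 1\<close>, the characters on pairs and on points belong to transitive actions and each contains the trivial
  character exactly once, so that \<open>H\<^sup>*\<^sub>1\<close> does not contain it. A permutation character without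
  trivial constituent belongs to an action without orbits and hence vanishes, whereas the value of \<open>H\<^sup>*\<^sub>1\<close> at the
  identity is \<open>n(n - 3)/2 > 0\<close>.
\<close>

section \<open>Invariant subsets and multisets of a permutation\<close>

definition invariant_subsets :: "'a set \<Rightarrow> ('a \<Rightarrow> 'a) \<Rightarrow> 'a set set" where
  "invariant_subsets A p = {S. S \<subseteq> A \<and> p ` S = S}"

definition invariant_multisets :: "'a set \<Rightarrow> ('a \<Rightarrow> 'a) \<Rightarrow> nat \<Rightarrow> ('a \<Rightarrow> nat) set" where
  "invariant_multisets A p k =
     {f. (\<forall>x. x \<notin> A \<longrightarrow> f x = 0) \<and> (\<forall>x\<in>A. f (p x) = f x) \<and> sum f A = k}"

definition multiset_series :: "'a set \<Rightarrow> ('a \<Rightarrow> 'a) \<Rightarrow> complex fps" where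
  "multiset_series A p = Abs_fps (\<lambda>k. of_nat (card (invariant_multisets A p k)))"

lemma finite_invariant_subsets: "finite A \<Longrightarrow> finite (invariant_subsets A p)"
  by (rule finite_subset[of _ "Pow A"]) (auto simp: invariant_subsets_def)

lemma finite_invariant_multisets:
  assumes "finite A"
  shows "finite (invariant_multisets A p k)"
proof (rule finite_subset)
  show "invariant_multisets A p k \<subseteq> {f. \<forall>x. (x \<in> A \<longrightarrow> f x \<in> {..k}) \<and> (x \<notin> A \<longrightarrow> f x = 0)}"
    using assms by (auto simp: invariant_multisets_def intro: member_le_sum)
  show "finite {f. \<forall>x. (x \<in> A \<longrightarrow> f x \<in> {..k}) \<and> (x \<notin> A \<longrightarrow> f x = 0)}"
    using assms by (intro finite_set_of_finite_funs) auto
qed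


section \<open>Adjoining one cycle\<close>

text \<open>Powers of a cycle rotate its list, and so carry any entry to any other entry.\<close>

lemma cycle_transitive:
  assumes cs: "distinct cs" and x: "x \<in> set cs" "x \<in> T"
    and T: "\<And>y. y \<in> set cs \<Longrightarrow> y \<in> T \<Longrightarrow> cycle_of_list cs y \<in> T"
  shows "set cs \<subseteq> T"
proof
  fix y assume "y \<in> set cs"
  then obtain j where j: "j < length cs" "y = cs ! j"
    by (auto simp: in_set_conv_nth)
  obtain i where i: "i < length cs" "x = cs ! i"
    using x by (auto simp: in_set_conv_nth)
  define k where "k = j + (length cs - i)"
  have iter: "(cycle_of_list cs ^^ r) x \<in> T \<inter> set cs" for r
    using x T cycle_is_surj[OF cs] by (induction r) auto
  have "(cycle_of_list cs ^^ k) x = rotate k cs ! i"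
    using cyclic_rotation[OF cs, of k] i by (metis nth_map)
  also have "\<dots> = y"
    using i j by (simp add: nth_rotate k_def)
  finally show "y \<in> T"
    using iter[of k] by simp
qed

text \<open>
  This is the usual sign \<open>(-1)\<^bsup>l-1\<^esup>\<close> of an \<open>l\<close>-cycle. In the form below it says that each cycle
  contributes exactly one sign to the expansion of the determinant.
\<close>

lemma sign_cycle_of_list:
  "distinct cs \<Longrightarrow> cs \<noteq> [] \<Longrightarrow> sign (cycle_of_list cs) * (- 1) ^ length cs = - 1"
proof (induction cs rule: cycle_of_list.induct)
  case (1 i j cs)
  have "sign (cycle_of_list (i # j # cs)) = - sign (cycle_of_list (j # cs))"
    using 1(2) by (simp add: sign_compose permutation_of_cycle permutation_swap_id sign_swap_id)
  then show ?case
    using 1 by (simp del: cycle_of_list.simps(1))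
qed auto

text \<open>
  The induction step along a cycle decomposition: one more cycle, on points outside the set \<open>I\<close>
  treated so far. A fixed point counts as a cycle of length \<open>1\<close>.
\<close>

locale disjoint_cycle =
  fixes cs :: "'a list" and I :: "'a set" and p :: "'a \<Rightarrow> 'a"
  assumes distinct: "distinct cs" and nonempty: "cs \<noteq> []"
    and p: "p permutes I" and finI: "finite I" and disj: "set cs \<inter> I = {}"
begin

definition q :: "'a \<Rightarrow> 'a" where "q = cycle_of_list cs \<circ> p"

lemma q_cycle: "x \<in> set cs \<Longrightarrow> q x = cycle_of_list cs x"
  using disj permutes_not_in[OF p, of x] by (auto simp: q_def disjoint_iff)

lemma q_rest: "x \<in> I \<Longrightarrow> q x = p x"
  using disj permutes_in_image[OF p, of x] by (auto simp: q_def intro!: id_outside_supp)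

lemma q_image_cycle: "q ` set cs = set cs"
  using cycle_is_surj[OF distinct] q_cycle by simp

lemma q_image_rest: "S \<subseteq> I \<Longrightarrow> q ` S = p ` S"
  by (intro image_cong) (auto simp: q_rest)

text \<open>
  The cycle acts transitively on its support, so an invariant set contains all of the
  support or none of it.
\<close>

lemma invariant_subsets_Un:
  "invariant_subsets (set cs \<union> I) q =
     invariant_subsets I p \<union> (\<union>) (set cs) ` invariant_subsets I p"
proof (intro equalityI subsetI)
  fix S assume "S \<in> invariant_subsets (set cs \<union> I) q"
  then have S: "S \<subseteq> set cs \<union> I" "q ` S = S"
    by (auto simp: invariant_subsets_def)
  have qI: "q x \<in> I \<longleftrightarrow> x \<in> I" if "x \<in> set cs \<union> I" for x
    using that q_rest[of x] permutes_in_image[OF p, of x] q_image_cycle disj by (auto)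
  have *: "p ` (S \<inter> I) = S \<inter> I"
  proof -
    have "p ` (S \<inter> I) = q ` (S \<inter> I)"
      by (rule q_image_rest[symmetric]) auto
    also have "\<dots> = q ` S \<inter> I"
      using S(1) qI by (auto)
    finally show ?thesis
      using S(2) by simp
  qed
  show "S \<in> invariant_subsets I p \<union> (\<union>) (set cs) ` invariant_subsets I p"
  proof (cases "S \<inter> set cs = {}")
    case True
    then have "S \<inter> I = S" using S by auto
    then show ?thesis
      using * by (auto simp: invariant_subsets_def)
  next
    case False
    then obtain x where "x \<in> set cs" "x \<in> S" by auto
    with distinct have "set cs \<subseteq> S"
    proof (rule cycle_transitive)
      fix y assume "y \<in> set cs" "y \<in> S"
      then show "cycle_of_list cs y \<in> S"
        using S(2) q_cycle[of y] by (metis imageI)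
    qed
    then have "S = set cs \<union> (S \<inter> I)"
      using S by auto
    moreover have "S \<inter> I \<in> invariant_subsets I p"
      using * by (auto simp: invariant_subsets_def)
    ultimately show ?thesis by blast
  qed
next
  fix S assume "S \<in> invariant_subsets I p \<union> (\<union>) (set cs) ` invariant_subsets I p"
  then obtain T where T: "T \<in> invariant_subsets I p" "S = T \<or> S = set cs \<union> T" by blast
  then have "q ` T = T"
    using q_image_rest[of T] by (auto simp: invariant_subsets_def)
  then show "S \<in> invariant_subsets (set cs \<union> I) q"
    using T q_image_cycle by (auto simp: invariant_subsets_def image_Un)
qed

lemma sum_invariant_subsets_Un:
  fixes w :: "'a set \<Rightarrow> 'b::comm_monoid_add"
  shows "(\<Sum>S\<in>invariant_subsets (set cs \<union> I) q. w S) =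
     (\<Sum>S\<in>invariant_subsets I p. w S) + (\<Sum>S\<in>invariant_subsets I p. w (set cs \<union> S))"
proof -
  have sub: "S \<subseteq> I" if "S \<in> invariant_subsets I p" for S
    using that by (auto simp: invariant_subsets_def)
  have "invariant_subsets I p \<inter> (\<union>) (set cs) ` invariant_subsets I p = {}"
    using sub disj nonempty by (fastforce simp: neq_Nil_conv)
  moreover have "inj_on ((\<union>) (set cs)) (invariant_subsets I p)"
    using sub disj by (intro inj_onI) blast
  ultimately show ?thesis
    unfolding invariant_subsets_Un
    by (subst sum.union_disjoint) (auto simp: finite_invariant_subsets finI sum.reindex)
qed

lemma card_cycle_Un: "S \<in> invariant_subsets I p \<Longrightarrow> card (set cs \<union> S) = length cs + card S"
  using disj finI distinct finite_subset[of S I]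
  by (subst card_Un_disjoint) (auto simp: invariant_subsets_def distinct_card)

lemma sign_on_rest: "S \<in> invariant_subsets I p \<Longrightarrow> sign_on S q = sign_on S p"
  by (rule sign_on_cong) (auto simp: invariant_subsets_def q_rest)

lemma sign_on_cycle_Un:
  assumes "S \<in> invariant_subsets I p"
  shows "sign_on (set cs \<union> S) q = sign (cycle_of_list cs) * sign_on S p"
proof -
  have S: "S \<subseteq> I" "p ` S = S"
    using assms by (auto simp: invariant_subsets_def)
  have "restrict_id q (set cs \<union> S) x = (cycle_of_list cs \<circ> restrict_id p S) x" for x
  proof (cases "x \<in> set cs")
    case True
    then have "x \<notin> S" "p x = x"
      using S disj permutes_not_in[OF p, of x] by auto
    with True show ?thesis by (simp add: q_def)
  next
    case False
    then show ?thesis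
      by (cases "x \<in> S") (auto simp: q_def id_outside_supp)
  qed
  then have "restrict_id q (set cs \<union> S) = cycle_of_list cs \<circ> restrict_id p S" ..
  moreover have "restrict_id p S permutes S"
    using S permutes_inj[OF p] by (intro permutes_restrict_id) (auto simp: bij_betw_def inj_on_def)
  then have "permutation (restrict_id p S)"
    using S finI by (meson finite_subset permutation_permutes)
  ultimately show ?thesis
    by (simp add: sign_on_def sign_compose permutation_of_cycle)
qed

text \<open>
  An invariant multiset is constant on the cycle. Either this constant is zero, which leaves
  a multiset on the rest, or one copy of the cycle can be taken away.
\<close>

lemma card_invariant_multisets_Un:
  "card (invariant_multisets (set cs \<union> I) q k) =
     card (invariant_multisets I p k) +
     (if length cs \<le> k then card (invariant_multisets (set cs \<union> I) q (k - length cs)) else 0)"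
proof -
  let ?A = "set cs \<union> I"
  let ?M = "invariant_multisets ?A q"
  define Z where "Z = {f \<in> ?M k. \<forall>x\<in>set cs. f x = 0}"
  define N where "N = {f \<in> ?M k. \<forall>x\<in>set cs. f x \<noteq> 0}"
  \<comment> \<open>one copy of the cycle\<close>
  define u where "u x = (if x \<in> set cs then 1 else 0::nat)" for x
  have fin: "finite (?M j)" for j
    by (rule finite_invariant_multisets) (use finI in simp)
  have q_in: "q x \<in> set cs \<longleftrightarrow> x \<in> set cs" if "x \<in> ?A" for x
    using that q_rest[of x] permutes_in_image[OF p, of x] q_image_cycle disj by (auto)
  have sumA: "sum f ?A = sum f (set cs) + sum f I" for f :: "'a \<Rightarrow> nat"
    using disj finI by (intro sum.union_disjoint) auto
  have u: "sum u ?A = length cs"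
    using disj distinct by (auto simp: sumA u_def distinct_card intro!: sum.neutral)
  have const: "f x = f y" if "f \<in> ?M j" "x \<in> set cs" "y \<in> set cs" for f j x y
  proof -
    have "set cs \<subseteq> {z. f z = f x}"
      using distinct that(2)
    proof (rule cycle_transitive)
      fix z assume "z \<in> set cs" "z \<in> {z. f z = f x}"
      then show "cycle_of_list cs z \<in> {z. f z = f x}"
        using that(1) by (auto simp: invariant_multisets_def simp flip: q_cycle)
    qed simp
    with that(3) show ?thesis by auto
  qed
  have "f \<in> Z \<union> N" if "f \<in> ?M k" for f
  proof -
    obtain c where c: "c \<in> set cs"
      using nonempty by (meson hd_in_set)
    then have "f x = f c" if "x \<in> set cs" for x
      using const[OF \<open>f \<in> ?M k\<close> that] by simp
    with that show ?thesis
      by (cases "f c = 0") (auto simp: Z_def N_def)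
  qed
  moreover have "Z \<subseteq> ?M k" "N \<subseteq> ?M k"
    by (auto simp: Z_def N_def)
  ultimately have ZN: "?M k = Z \<union> N"
    by blast
  have "Z \<inter> N = {}"
    using nonempty by (auto simp: Z_def N_def neq_Nil_conv)
  then have "card (?M k) = card Z + card N"
    unfolding ZN using fin[of k] ZN by (intro card_Un_disjoint) auto
  moreover have "Z = invariant_multisets I p k"
  proof (intro equalityI subsetI)
    fix f assume f: "f \<in> Z"
    then have z: "f x = 0" if "x \<notin> I" for x
      using that by (auto simp: Z_def invariant_multisets_def)
    have "f (p x) = f x" if "x \<in> I" for x
      using f that by (auto simp: Z_def invariant_multisets_def simp flip: q_rest)
    moreover have "sum f (set cs) = 0"
      using f by (simp add: Z_def)
    then have "sum f I = k"
      using f sumA[of f] by (simp add: Z_def invariant_multisets_def)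
    ultimately show "f \<in> invariant_multisets I p k"
      using z by (auto simp: invariant_multisets_def)
  next
    fix f assume f: "f \<in> invariant_multisets I p k"
    have z: "f x = 0" if "x \<in> set cs" for x
      using f that disj by (auto simp: invariant_multisets_def)
    have "f (q x) = f x" if "x \<in> ?A" for x
    proof (cases "x \<in> set cs")
      case True
      then show ?thesis using z q_in[of x] that by metis
    next
      case False
      then have "x \<in> I" using that by simp
      then show ?thesis using f q_rest[of x] by (auto simp: invariant_multisets_def)
    qed
    moreover have "sum f (set cs) = 0"
      using z by simp
    then have "sum f ?A = k"
      using f by (simp add: sumA invariant_multisets_def)
    ultimately show "f \<in> Z"
      using f z by (auto simp: Z_def invariant_multisets_def)
  qed
  moreover have "card N = (if length cs \<le> k then card (?M (k - length cs)) else 0)"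
  proof (cases "length cs \<le> k")
    case True
    have "bij_betw (\<lambda>f x. f x + u x) (?M (k - length cs)) N"
    proof (rule bij_betw_byWitness[where f' = "\<lambda>f x. f x - u x"])
      show "(\<lambda>f x. f x + u x) ` ?M (k - length cs) \<subseteq> N"
      proof (rule image_subsetI)
        fix f assume f: "f \<in> ?M (k - length cs)"
        have "u (q x) = u x" if "x \<in> ?A" for x
          using q_in[OF that] by (simp add: u_def)
        then show "(\<lambda>x. f x + u x) \<in> N"
          using f u True
          by (auto simp: N_def invariant_multisets_def sum.distrib u_def)
      qed
      show "(\<lambda>f x. f x - u x) ` N \<subseteq> ?M (k - length cs)"
      proof (rule image_subsetI)
        fix f assume f: "f \<in> N"
        have uq: "u (q x) = u x" if "x \<in> ?A" for x
          using q_in[OF that] by (simp add: u_def)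
        have "u x \<le> f x" if "x \<in> ?A" for x
          using f that by (auto simp: N_def u_def Suc_le_eq)
        then have "sum (\<lambda>x. f x - u x) ?A = sum f ?A - sum u ?A"
          by (intro sum_subtractf_nat) 
        then show "(\<lambda>x. f x - u x) \<in> ?M (k - length cs)"
          using f u uq by (auto simp: N_def invariant_multisets_def)
      qed
    qed (auto simp: N_def u_def fun_eq_iff Suc_le_eq)
    then show ?thesis
      using True bij_betw_same_card by force
  next
    case False
    have "length cs \<le> k" if "f \<in> N" for f
    proof -
      have "sum u ?A \<le> sum f ?A"
        using that by (intro sum_mono) (auto simp: N_def u_def Suc_le_eq)
      then show ?thesis
        using that u by (simp add: N_def invariant_multisets_def)
    qed
    with False have "N = {}" by blast
    with False show ?thesis by simp
  qed
  ultimately show ?thesis by simp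
qed

lemma multiset_series_Un:
  "multiset_series (set cs \<union> I) q * (1 - fps_X ^ length cs) = multiset_series I p"
proof -
  have "multiset_series (set cs \<union> I) q =
          multiset_series I p + fps_X ^ length cs * multiset_series (set cs \<union> I) q"
  proof (rule fps_ext)
    fix k
    show "fps_nth (multiset_series (set cs \<union> I) q) k =
        fps_nth (multiset_series I p + fps_X ^ length cs * multiset_series (set cs \<union> I) q) k"
      using card_invariant_multisets_Un[of k]
      by (simp add: multiset_series_def fps_X_power_mult_nth)
  qed
  then show ?thesis
    by (simp add: algebra_simps)
qed

end


section \<open>Generating functions in terms of the cycle lengths\<close>

text \<open>
  This is the shape in which the Leibniz formula delivers the determinant of
  \<open>1 - t\<rho>\<close>, see \<open>leibniz_identity_minus_permutation\<close> below.
\<close>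

definition signed_subset_series :: "'a set \<Rightarrow> ('a \<Rightarrow> 'a) \<Rightarrow> complex fps" where
  "signed_subset_series A p =
     (\<Sum>S\<in>invariant_subsets A p. of_int (sign_on S p) * (- fps_X) ^ card S)"

definition subset_series :: "'a set \<Rightarrow> ('a \<Rightarrow> 'a) \<Rightarrow> complex fps" where
  "subset_series A p = (\<Sum>S\<in>invariant_subsets A p. fps_X ^ card S)"

lemma (in disjoint_cycle) subset_series_Un:
  "subset_series (set cs \<union> I) q = (1 + fps_X ^ length cs) * subset_series I p"
proof -
  have "(\<Sum>S\<in>invariant_subsets I p. fps_X ^ card (set cs \<union> S)) =
          (fps_X ^ length cs * subset_series I p :: complex fps)"
    by (simp add: subset_series_def card_cycle_Un power_add sum_distrib_left)
  then show ?thesis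
    by (simp add: subset_series_def sum_invariant_subsets_Un algebra_simps)
qed

lemma (in disjoint_cycle) signed_subset_series_Un:
  "signed_subset_series (set cs \<union> I) q = (1 - fps_X ^ length cs) * signed_subset_series I p"
proof -
  have l: "of_int (sign (cycle_of_list cs)) * (- fps_X) ^ length cs = - (fps_X ^ length cs :: complex fps)"
  proof -
    have "of_int (sign (cycle_of_list cs)) * (- fps_X) ^ length cs =
      (of_int (sign (cycle_of_list cs) * (- 1) ^ length cs) * fps_X ^ length cs :: complex fps)"
      by (subst power_minus) (simp add: mult.assoc)
    also have "\<dots> = - (fps_X ^ length cs)"
      using sign_cycle_of_list[OF distinct nonempty] by simp
    finally show ?thesis .
  qed
  have "(\<Sum>S\<in>invariant_subsets I p. of_int (sign_on (set cs \<union> S) q) * (- fps_X) ^ card (set cs \<union> S)) =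
     (\<Sum>S\<in>invariant_subsets I p. (of_int (sign (cycle_of_list cs)) * (- fps_X) ^ length cs) *
           (of_int (sign_on S p) * (- fps_X) ^ card S) :: complex fps)"
    by (intro sum.cong refl) (simp add: card_cycle_Un sign_on_cycle_Un power_add mult_ac)
  also have "\<dots> = - (fps_X ^ length cs) * signed_subset_series I p"
    unfolding l by (simp add: signed_subset_series_def sum_distrib_left)
  finally have "signed_subset_series (set cs \<union> I) q =
      (\<Sum>S\<in>invariant_subsets I p. of_int (sign_on S q) * (- fps_X) ^ card S) +
      - (fps_X ^ length cs) * signed_subset_series I p"
    by (simp only: signed_subset_series_def sum_invariant_subsets_Un)
  also have "(\<Sum>S\<in>invariant_subsets I p. of_int (sign_on S q) * (- fps_X) ^ card S) =
      signed_subset_series I p"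
    unfolding signed_subset_series_def by (intro sum.cong refl) (simp only: sign_on_rest)
  finally show ?thesis
    by (simp add: algebra_simps)
qed

text \<open>
  Peeling off one cycle of length \<open>l\<close> multiplies the three series by \<open>1 - t\<^sup>l\<close>, \<open>1 + t\<^sup>l\<close> and
  \<open>1 / (1 - t\<^sup>l)\<close>; the list \<open>ls\<close> collects the cycle lengths.
\<close>

lemma generating_functions_cycle_lengths:
  assumes "p permutes A" "finite A"
  shows "\<exists>ls. signed_subset_series A p = (\<Prod>l\<leftarrow>ls. 1 - fps_X ^ l) \<and>
    subset_series A p = (\<Prod>l\<leftarrow>ls. 1 + fps_X ^ l) \<and>
    multiset_series A p * (\<Prod>l\<leftarrow>ls. 1 - fps_X ^ l) = 1"
proof -
  have "cycle_decomp A p"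
    using assms by (rule cycle_decomposition)
  then have "finite A \<and> p permutes A \<and> (\<exists>ls. signed_subset_series A p = (\<Prod>l\<leftarrow>ls. 1 - fps_X ^ l) \<and>
    subset_series A p = (\<Prod>l\<leftarrow>ls. 1 + fps_X ^ l) \<and>
    multiset_series A p * (\<Prod>l\<leftarrow>ls. 1 - fps_X ^ l) = 1)"
  proof induction
    case empty
    have "invariant_subsets {} (id :: 'a \<Rightarrow> 'a) = {{}}"
      by (auto simp: invariant_subsets_def)
    moreover have "invariant_multisets {} (id :: 'a \<Rightarrow> 'a) k = (if k = 0 then {\<lambda>_. 0} else {})" for k
      by (auto simp: invariant_multisets_def)
    then have "multiset_series {} (id :: 'a \<Rightarrow> 'a) = 1"
      by (intro fps_ext) (simp add: multiset_series_def)
    ultimately show ?case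
      by (intro conjI exI[of _ "[]"])
        (simp_all add: signed_subset_series_def subset_series_def permutes_id id_def)
  next
    case (comp I p cs)
    show ?case
    \<comment> \<open>An empty cycle does not alter the permutation and must not contribute the factor \<open>1 - t\<^sup>0 = 0\<close>.\<close>
    proof (cases "cs = []")
      case True
      then show ?thesis using comp by simp
    next
      case False
      then interpret disjoint_cycle cs I p
        using comp by unfold_locales auto
      from comp obtain ls where ls:
        "signed_subset_series I p = (\<Prod>l\<leftarrow>ls. 1 - fps_X ^ l)"
        "subset_series I p = (\<Prod>l\<leftarrow>ls. 1 + fps_X ^ l)"
        "multiset_series I p * (\<Prod>l\<leftarrow>ls. 1 - fps_X ^ l) = 1" by blast
      have "q permutes set cs \<union> I"
        unfolding q_def using cycle_permutes[of cs] p
        by (intro permutes_compose) (auto elim: permutes_subset)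
      then show ?thesis
        unfolding q_def[symmetric] using ls finI
        by (intro conjI exI[of _ "length cs # ls"])
           (auto simp: subset_series_Un signed_subset_series_Un mult.assoc[symmetric]
               multiset_series_Un)
    qed
  qed
  then show ?thesis by blast
qed

lemma signed_subset_series_times_multiset_series:
  assumes "p permutes A" "finite A"
  shows "signed_subset_series A p * multiset_series A p = 1"
  using generating_functions_cycle_lengths[OF assms] by (auto simp: mult.commute)

text \<open>This is \<open>1 - t\<^bsup>2l\<^esup> = (1 + t\<^sup>l) (1 - t\<^sup>l)\<close>, multiplied over all cycles.\<close>

lemma signed_subset_series_squared_variable:
  assumes "p permutes A" "finite A"
  shows "(signed_subset_series A p oo fps_X\<^sup>2) * multiset_series A p = subset_series A p"
proof -
  obtain ls where ls: "signed_subset_series A p = (\<Prod>l\<leftarrow>ls. 1 - fps_X ^ l)"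
      "subset_series A p = (\<Prod>l\<leftarrow>ls. 1 + fps_X ^ l)"
      "multiset_series A p * (\<Prod>l\<leftarrow>ls. 1 - fps_X ^ l) = 1"
    using generating_functions_cycle_lengths[OF assms] by blast
  have "(\<Prod>l\<leftarrow>ls. 1 - fps_X ^ l :: complex fps) oo fps_X\<^sup>2 =
      (\<Prod>l\<leftarrow>ls. 1 + fps_X ^ l) * (\<Prod>l\<leftarrow>ls. 1 - fps_X ^ l)"
  proof (induction ls)
    case (Cons l ls)
    have "(1 - fps_X ^ l :: complex fps) oo fps_X\<^sup>2 = (1 + fps_X ^ l) * (1 - fps_X ^ l)"
      by (simp add: fps_compose_sub_distrib fps_X_power_compose algebra_simps
          flip: power_mult power_add mult_2)
    with Cons show ?case
      by (simp add: fps_compose_mult_distrib mult_ac)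
  qed simp
  then show ?thesis
    using ls by (simp add: mult_ac)
qed

lemma subset_series_nth:
  assumes "finite A"
  shows "fps_nth (subset_series A p) k = of_nat (card {S \<in> invariant_subsets A p. card S = k})"
  using finite_invariant_subsets[OF assms, of p]
  by (simp add: subset_series_def fps_sum_nth fps_X_power_nth sum.If_cases Int_def eq_commute)

text \<open>Comparing the even coefficients in the preceding identity.\<close>

lemma signed_subset_series_times_even_part:
  assumes "p permutes A" "finite A"
  shows "fps_nth (signed_subset_series A p *
            Abs_fps (\<lambda>d. fps_nth (multiset_series A p) (2 * d))) m =
         of_nat (card {S \<in> invariant_subsets A p. card S = 2 * m})"
proof -
  let ?D = "signed_subset_series A p" and ?P = "multiset_series A p"
  have nth: "fps_nth (?D oo fps_X\<^sup>2) k = (if even k then fps_nth ?D (k div 2) else 0)" for k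
  proof -
    have "fps_nth (?D oo fps_X\<^sup>2) k = (\<Sum>i=0..k. if k = 2 * i then fps_nth ?D i else 0)"
      by (auto simp: fps_compose_nth fps_X_power_nth simp flip: power_mult intro!: sum.cong)
    also have "\<dots> = (\<Sum>i\<in>{0..k}. if i = k div 2 then (if even k then fps_nth ?D i else 0) else 0)"
      by (intro sum.cong) auto
    also have "\<dots> = (if even k then fps_nth ?D (k div 2) else 0)"
      by (subst sum.delta) auto
    finally show ?thesis .
  qed
  have "fps_nth (?D * Abs_fps (\<lambda>d. fps_nth ?P (2 * d))) m =
      (\<Sum>i\<in>{0..m}. fps_nth (?D oo fps_X\<^sup>2) (2 * i) * fps_nth ?P (2 * m - 2 * i))"
    by (simp add: fps_mult_nth nth right_diff_distrib')
  also have "\<dots> = (\<Sum>k\<in>(*) 2 ` {0..m}. fps_nth (?D oo fps_X\<^sup>2) k * fps_nth ?P (2 * m - k))"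
    by (subst sum.reindex) (auto simp: inj_on_def)
  also have "\<dots> = (\<Sum>k\<in>{0..2 * m}. fps_nth (?D oo fps_X\<^sup>2) k * fps_nth ?P (2 * m - k))"
    by (rule sum.mono_neutral_left) (auto simp: nth image_iff elim!: evenE)
  also have "\<dots> = fps_nth (subset_series A p) (2 * m)"
    by (simp add: fps_mult_nth flip: signed_subset_series_squared_variable[OF assms])
  finally show ?thesis
    using assms by (simp add: subset_series_nth)
qed


section \<open>The determinant\<close>

text \<open>
  A permutation \<open>p\<close> contributes to the Leibniz formula only if every point is either fixed by \<open>p\<close>
  or moved as \<open>q\<close> moves it. Expanding the product over the set \<open>S\<close> of points where the second
  alternative is chosen forces \<open>p\<close> to be \<open>q\<close> on \<open>S\<close> and the identity elsewhere, which is a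
  permutation exactly when \<open>S\<close> is invariant under \<open>q\<close>.
\<close>

lemma leibniz_identity_minus_permutation:
  fixes x :: "'b::comm_ring_1"
  assumes A: "finite A" and q: "q permutes A"
  shows "(\<Sum>p | p permutes A. of_int (sign p) *
            (\<Prod>j\<in>A. (if p j = j then 1 else 0) - x * (if p j = q j then 1 else 0))) =
         (\<Sum>S\<in>invariant_subsets A q. of_int (sign_on S q) * (- x) ^ card S)"
proof -
  let ?P = "{p. p permutes A}"
  let ?follows = "\<lambda>p S. (\<forall>j\<in>S. p j = q j) \<and> (\<forall>j\<in>A - S. p j = j)"
  have finP: "finite ?P"
    using A by (rule finite_permutations)
  have follows: "?follows p S \<longleftrightarrow> p = restrict_id q S" if "p permutes A" "S \<subseteq> A" for p S
    using that permutes_not_in[OF that(1)] by (auto simp: fun_eq_iff restrict_id_def)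
  have permutes: "restrict_id q S permutes A \<longleftrightarrow> q ` S = S" if "S \<subseteq> A" for S
  proof
    assume r: "restrict_id q S permutes A"
    have "q ` S \<subseteq> S"
    proof (rule image_subsetI, rule ccontr)
      fix j assume j: "j \<in> S" "q j \<notin> S"
      then have "restrict_id q S j = restrict_id q S (q j)" by simp
      with r have "j = q j" by (metis permutes_def)
      with j show False by simp
    qed
    moreover have "inj_on q S"
      using q by (rule permutes_inj_on)
    ultimately show "q ` S = S"
      using A that by (metis card_image card_subset_eq finite_subset)
  next
    assume "q ` S = S"
    then have "restrict_id q S permutes S"
      using permutes_inj_on[OF q] by (intro permutes_restrict_id) (auto simp: bij_betw_def)
    then show "restrict_id q S permutes A"
      using that by (rule permutes_subset)
  qed
  have expand: "(\<Prod>j\<in>A. (if p j = j then 1 else 0) - x * (if p j = q j then 1 else 0)) =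
      (\<Sum>S\<in>Pow A. if p = restrict_id q S then (- x) ^ card S else 0)" if "p permutes A" for p
  proof -
    have "(\<Prod>j\<in>A. (if p j = j then 1 else 0) - x * (if p j = q j then 1 else 0)) =
        (\<Prod>j\<in>A. (if p j = q j then - x else 0) + (if p j = j then 1 else 0))"
      by (intro prod.cong) auto
    also have "\<dots> = (\<Sum>S\<in>Pow A. (\<Prod>j\<in>S. if p j = q j then - x else 0) *
                                (\<Prod>j\<in>A - S. if p j = j then 1 else 0))"
      using A by (rule prod_add)
    also have "\<dots> = (\<Sum>S\<in>Pow A. if ?follows p S then (- x) ^ card S else 0)"
    proof (intro sum.cong refl)
      fix S assume "S \<in> Pow A"
      then have fin: "finite S" "finite (A - S)"
        using A finite_subset by auto
      have "(\<Prod>j\<in>S. if p j = q j then - x else 0) = (if \<forall>j\<in>S. p j = q j then (- x) ^ card S else 0)"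
        using fin(1) by (auto simp: prod_zero_iff intro!: prod_zero)
      moreover have "(\<Prod>j\<in>A - S. if p j = j then 1 else 0) = (if \<forall>j\<in>A - S. p j = j then 1 else (0 :: 'b))"
      proof (cases "\<forall>j\<in>A - S. p j = j")
        case False
        then have "(\<Prod>j\<in>A - S. if p j = j then 1 else (0 :: 'b)) = 0"
          using fin(2) by (intro prod_zero) auto
        with False show ?thesis by simp
      qed simp
      ultimately show "(\<Prod>j\<in>S. if p j = q j then - x else 0) * (\<Prod>j\<in>A - S. if p j = j then 1 else 0) =
          (if ?follows p S then (- x) ^ card S else 0)"
        by simp
    qed
    also have "\<dots> = (\<Sum>S\<in>Pow A. if p = restrict_id q S then (- x) ^ card S else 0)"
      by (intro sum.cong refl if_cong) (use follows[OF that] in auto)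
    finally show ?thesis .
  qed
  have "(\<Sum>p\<in>?P. of_int (sign p) *
            (\<Prod>j\<in>A. (if p j = j then 1 else 0) - x * (if p j = q j then 1 else 0))) =
        (\<Sum>p\<in>?P. \<Sum>S\<in>Pow A. if p = restrict_id q S then of_int (sign p) * (- x) ^ card S else 0)"
    by (intro sum.cong refl) (auto simp: expand sum_distrib_left intro!: sum.cong)
  also have "\<dots> = (\<Sum>S\<in>Pow A. \<Sum>p\<in>?P. if p = restrict_id q S then of_int (sign p) * (- x) ^ card S else 0)"
    by (rule sum.swap)
  also have "\<dots> = (\<Sum>S\<in>Pow A. if q ` S = S then of_int (sign_on S q) * (- x) ^ card S else 0)"
    by (intro sum.cong refl) (simp add: finP permutes sign_on_def)
  also have "\<dots> = (\<Sum>S\<in>invariant_subsets A q. of_int (sign_on S q) * (- x) ^ card S)"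
    using A by (simp add: sum.If_cases invariant_subsets_def Int_def)
  finally show ?thesis .
qed

text \<open>
  The permutation of the indices \<open>{..<n}\<close> of vectors and matrices that corresponds to the
  permutation \<open>\<sigma>\<close> of \<open>{1..n}\<close>.
\<close>

definition shift_perm :: "nat \<Rightarrow> (nat \<Rightarrow> nat) \<Rightarrow> nat \<Rightarrow> nat" where
  "shift_perm n \<sigma> i = (if i < n then \<sigma> (Suc i) - 1 else i)"

lemma Suc_shift_perm:
  assumes "\<sigma> permutes {1..n}" "i < n"
  shows "Suc (shift_perm n \<sigma> i) = \<sigma> (Suc i)"
  using permutes_in_image[OF assms(1), of "Suc i"] assms(2) by (simp add: shift_perm_def)

lemma shift_perm_permutes:
  assumes "\<sigma> permutes {1..n}"
  shows "shift_perm n \<sigma> permutes {..<n}"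
proof (rule bij_imp_permutes)
  have in_range: "shift_perm n \<sigma> i < n" if "i < n" for i
    using Suc_shift_perm[OF assms that] permutes_in_image[OF assms, of "Suc i"] that by simp
  have "inj_on (shift_perm n \<sigma>) {..<n}"
  proof (rule inj_onI)
    fix i j assume "i \<in> {..<n}" "j \<in> {..<n}" "shift_perm n \<sigma> i = shift_perm n \<sigma> j"
    then have "\<sigma> (Suc i) = \<sigma> (Suc j)"
      using Suc_shift_perm[OF assms] by (metis lessThan_iff)
    then show "i = j"
      using permutes_inj[OF assms] by (simp add: inj_eq)
  qed
  then show "bij_betw (shift_perm n \<sigma>) {..<n} {..<n}"
    using in_range endo_inj_surj[of "{..<n}" "shift_perm n \<sigma>"] by (auto simp: bij_betw_def)
qed (simp add: shift_perm_def)

lemma det_series_eq: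
  assumes "\<sigma> permutes {1..n}"
  shows "det_series n \<sigma> = signed_subset_series {..<n} (shift_perm n \<sigma>)"
proof -
  let ?M = "1\<^sub>m n - fps_X \<cdot>\<^sub>m perm_mat n \<sigma> :: complex fps mat"
  have "det_series n \<sigma> = (\<Sum>p | p permutes {..<n}. of_int (sign p) * (\<Prod>j<n. ?M $$ (p j, j)))"
    unfolding det_series_def
    by (subst det_col[of _ n]) (auto simp: perm_mat_def lessThan_atLeast0)
  also have "\<dots> = (\<Sum>p | p permutes {..<n}. of_int (sign p) *
      (\<Prod>j<n. (if p j = j then 1 else 0) - fps_X * (if p j = shift_perm n \<sigma> j then 1 else 0)))"
  proof (intro sum.cong refl arg_cong2[where f = "(*)"] prod.cong)
    fix p j assume "p \<in> {p. p permutes {..<n}}" "j \<in> {..<n}"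
    then have j: "j < n" "p j < n"
      using permutes_in_image[of p "{..<n}" j] by auto
    have "Suc (p j) = \<sigma> (Suc j) \<longleftrightarrow> p j = shift_perm n \<sigma> j"
      using Suc_shift_perm[OF assms j(1)] by auto
    then show "?M $$ (p j, j) =
        (if p j = j then 1 else 0) - fps_X * (if p j = shift_perm n \<sigma> j then 1 else 0)"
      using j by (simp add: perm_mat_def)
  qed
  also have "\<dots> = signed_subset_series {..<n} (shift_perm n \<sigma>)"
    unfolding signed_subset_series_def
    by (rule leibniz_identity_minus_permutation) (use shift_perm_permutes[OF assms] in auto)
  finally show ?thesis .
qed


section \<open>Counting the fixed lattice points\<close>

text \<open>
  Two points cannot both have multiplicity above \<open>d\<close> in a multiset of size \<open>2d\<close>. As an invariant
  multiset is constant along cycles, a point of such multiplicity is fixed by \<open>p\<close>, and removing \<open>d + 1\<close>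
  copies of it is reversible.
\<close>

lemma card_invariant_multisets_large_entry:
  assumes A: "finite A" and p: "p permutes A" and d: "d \<ge> 1"
  shows "card {f \<in> invariant_multisets A p (2 * d). \<exists>x\<in>A. d < f x} =
         card {x \<in> A. p x = x} * card (invariant_multisets A p (d - 1))"
proof -
  define u where "u = (\<lambda>(x, g :: 'a \<Rightarrow> nat). g(x := g x + Suc d))"
  let ?F = "{x \<in> A. p x = x}" and ?M = "invariant_multisets A p"
  have p_in: "p x \<in> A" if "x \<in> A" for x
    using that permutes_in_image[OF p] by simp
  have p_eq: "p x = y \<longleftrightarrow> x = y" if "y \<in> ?F" for x y
    using that permutes_inj[OF p] by (auto simp: inj_def)
  have sum_upd: "sum (f(x := c)) A + f x = sum f A + c" if "x \<in> A" for f :: "'a \<Rightarrow> nat" and x c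
    using A that by (simp add: sum.remove[of A x])
  \<comment> \<open>This bound lets the point that received \<open>d + 1\<close> further copies be recovered\<close>
  have small: "g y < Suc d" if "g \<in> ?M (d - 1)" for g y
  proof (cases "y \<in> A")
    case True
    then have "g y \<le> d - 1"
      using A that member_le_sum[of y A g] by (simp add: invariant_multisets_def)
    then show ?thesis by simp
  qed (use that in \<open>simp add: invariant_multisets_def\<close>)
  have "inj_on u (?F \<times> ?M (d - 1))"
  proof (rule inj_onI)
    fix a b assume ab: "a \<in> ?F \<times> ?M (d - 1)" "b \<in> ?F \<times> ?M (d - 1)" "u a = u b"
    obtain x g where a: "a = (x, g)" by fastforce
    obtain y h where b: "b = (y, h)" by fastforce
    have eq: "(g(x := g x + Suc d)) z = (h(y := h y + Suc d)) z" for z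
      using ab(3) by (simp add: a b u_def)
    have "g \<in> ?M (d - 1)" "h \<in> ?M (d - 1)"
      using ab by (simp_all add: a b)
    then have "x = y"
      using eq[of x] small[of h x] by (cases "x = y") auto
    moreover have "g z = h z" for z
      using eq[of z] \<open>x = y\<close> by (cases "z = x") auto
    ultimately show "a = b"
      by (simp add: a b fun_eq_iff)
  qed
  moreover have "u ` (?F \<times> ?M (d - 1)) = {f \<in> ?M (2 * d). \<exists>x\<in>A. d < f x}"
  proof (intro equalityI subsetI)
    fix f assume "f \<in> u ` (?F \<times> ?M (d - 1))"
    then obtain x g where xg: "x \<in> ?F" "g \<in> ?M (d - 1)" "f = g(x := g x + Suc d)"
      by (auto simp: u_def)
    have "sum f A = 2 * d"
      using sum_upd[of x g "g x + Suc d"] xg d by (simp add: invariant_multisets_def)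
    moreover have "f (p y) = f y" if "y \<in> A" for y
      using xg that p_eq[OF xg(1), of y] by (auto simp: invariant_multisets_def)
    ultimately show "f \<in> {f \<in> ?M (2 * d). \<exists>x\<in>A. d < f x}"
      using xg by (auto simp: invariant_multisets_def)
  next
    fix f assume "f \<in> {f \<in> ?M (2 * d). \<exists>x\<in>A. d < f x}"
    then obtain x where x: "x \<in> A" "d < f x" and f: "f \<in> ?M (2 * d)" by blast
    have "p x = x"
    proof (rule ccontr)
      assume "p x \<noteq> x"
      then have "f x + f (p x) = sum f {x, p x}" by simp
      also have "\<dots> \<le> sum f A"
        using A x p_in by (intro sum_mono2) auto
      finally show False
        using f x by (simp add: invariant_multisets_def)
    qed
    then have xF: "x \<in> ?F" using x by simp
    define g where "g = f(x := f x - Suc d)"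
    have "sum g A = d - 1"
      using sum_upd[of x f "f x - Suc d"] x f unfolding g_def by (simp add: invariant_multisets_def)
    moreover have "g (p y) = g y" if "y \<in> A" for y
      using f that p_eq[OF xF, of y] \<open>p x = x\<close> by (auto simp: g_def invariant_multisets_def)
    ultimately have "g \<in> ?M (d - 1)"
      using f x by (auto simp: g_def invariant_multisets_def)
    moreover have "f = u (x, g)"
      using x by (auto simp: u_def g_def)
    ultimately show "f \<in> u ` (?F \<times> ?M (d - 1))"
      using xF by blast
  qed
  ultimately have "bij_betw u (?F \<times> ?M (d - 1)) {f \<in> ?M (2 * d). \<exists>x\<in>A. d < f x}"
    by (rule bij_betw_imageI)
  from bij_betw_same_card[OF this] show ?thesis
    by (simp add: card_cartesian_product)
qed

lemma mem_dilate_lattice_points: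
  assumes "d \<ge> 1"
  shows "x \<in> dilate_lattice_points n d \<longleftrightarrow>
    x \<in> carrier_vec n \<and> (\<forall>i<n. x $ i \<in> \<int> \<and> 0 \<le> x $ i \<and> x $ i \<le> real d) \<and>
    (\<Sum>i<n. x $ i) = 2 * real d"
proof
  assume "x \<in> dilate_lattice_points n d"
  then show "x \<in> carrier_vec n \<and> (\<forall>i<n. x $ i \<in> \<int> \<and> 0 \<le> x $ i \<and> x $ i \<le> real d) \<and>
      (\<Sum>i<n. x $ i) = 2 * real d"
    by (auto simp: dilate_lattice_points_def second_hypersimplex_def mult_left_le
        simp flip: sum_distrib_left)
next
  assume x: "x \<in> carrier_vec n \<and> (\<forall>i<n. x $ i \<in> \<int> \<and> 0 \<le> x $ i \<and> x $ i \<le> real d) \<and>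
      (\<Sum>i<n. x $ i) = 2 * real d"
  define y where "y = (1 / real d) \<cdot>\<^sub>v x"
  have "x = real d \<cdot>\<^sub>v y"
    using assms by (simp add: y_def smult_smult_assoc)
  moreover have "y \<in> second_hypersimplex n"
    using x assms
    by (auto simp: y_def second_hypersimplex_def simp flip: sum_divide_distrib)
  ultimately show "x \<in> dilate_lattice_points n d"
    using x by (auto simp: dilate_lattice_points_def)
qed

lemma perm_mat_mult_vec:
  fixes x :: "real vec"
  assumes "\<sigma> permutes {1..n}" "x \<in> carrier_vec n" "j < n"
  shows "(perm_mat n \<sigma> *\<^sub>v x) $ shift_perm n \<sigma> j = x $ j"
proof -
  have s: "shift_perm n \<sigma> j < n"
    using permutes_in_image[OF shift_perm_permutes[OF assms(1)], of j] assms(3) by simp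
  have eq: "Suc (shift_perm n \<sigma> j) = \<sigma> (Suc k) \<longleftrightarrow> k = j" for k
    using Suc_shift_perm[OF assms(1,3)] permutes_inj[OF assms(1)] by (auto simp: inj_eq)
  have "(perm_mat n \<sigma> *\<^sub>v x) $ shift_perm n \<sigma> j =
      (\<Sum>k\<in>{0..<n}. (if Suc (shift_perm n \<sigma> j) = \<sigma> (Suc k) then 1 else 0) * x $ k)"
    using s assms(2) by (simp add: perm_mat_def mult_mat_vec_def scalar_prod_def)
  also have "\<dots> = (\<Sum>k\<in>{0..<n}. if k = j then x $ k else 0)"
    unfolding eq by (intro sum.cong refl) simp
  finally show ?thesis using assms(3) by simp
qed

lemma perm_mat_fixes_iff:
  fixes x :: "real vec"
  assumes \<sigma>: "\<sigma> permutes {1..n}" and x: "x \<in> carrier_vec n"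
  shows "perm_mat n \<sigma> *\<^sub>v x = x \<longleftrightarrow> (\<forall>j<n. x $ shift_perm n \<sigma> j = x $ j)"
proof
  assume "perm_mat n \<sigma> *\<^sub>v x = x"
  then show "\<forall>j<n. x $ shift_perm n \<sigma> j = x $ j"
    using perm_mat_mult_vec[OF assms] by simp
next
  assume R: "\<forall>j<n. x $ shift_perm n \<sigma> j = x $ j"
  show "perm_mat n \<sigma> *\<^sub>v x = x"
  proof (rule eq_vecI)
    fix i assume "i < dim_vec x"
    then have "i \<in> shift_perm n \<sigma> ` {..<n}"
      using x permutes_image[OF shift_perm_permutes[OF \<sigma>]] by auto
    then obtain j where "j < n" "i = shift_perm n \<sigma> j" by auto
    then show "(perm_mat n \<sigma> *\<^sub>v x) $ i = x $ i"
      using R perm_mat_mult_vec[OF assms] by simp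
  qed (use x in \<open>simp add: perm_mat_def\<close>)
qed

lemma card_fixed_lattice_points:
  assumes \<sigma>: "\<sigma> permutes {1..n}" and d: "d \<ge> 1"
  shows "card (invariants (dilate_lattice_points n d) (\<lambda>\<tau> x. perm_mat n \<tau> *\<^sub>v x) \<sigma>) =
         card {f \<in> invariant_multisets {..<n} (shift_perm n \<sigma>) (2 * d). \<not> (\<exists>x\<in>{..<n}. d < f x)}"
    (is "card ?L = card ?R")
proof -
  have s: "shift_perm n \<sigma> j < n" if "j < n" for j
    using permutes_in_image[OF shift_perm_permutes[OF \<sigma>], of j] that by simp
  let ?v = "\<lambda>f. vec n (\<lambda>i. real (f i))"
  have "bij_betw ?v ?R ?L"
    unfolding bij_betw_def
  proof (intro conjI equalityI subsetI)
    show "inj_on ?v ?R"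
    proof (rule inj_onI)
      fix f g assume fg: "f \<in> ?R" "g \<in> ?R" "?v f = ?v g"
      show "f = g"
      proof
        fix i show "f i = g i"
        proof (cases "i < n")
          case True
          then have "?v f $ i = ?v g $ i" using fg(3) by simp
          with True show ?thesis by simp
        qed (use fg in \<open>auto simp: invariant_multisets_def\<close>)
      qed
    qed
  next
    fix x assume "x \<in> ?v ` ?R"
    then obtain f where f: "f \<in> ?R" "x = ?v f" by blast
    have "(\<Sum>i<n. f i) = 2 * d"
      using f by (simp add: invariant_multisets_def)
    then have "(\<Sum>i<n. real (f i)) = 2 * real d"
      by (metis of_nat_sum of_nat_mult of_nat_numeral)
    then show "x \<in> ?L"
      using f s by (auto simp: invariants_def mem_dilate_lattice_points[OF d] perm_mat_fixes_iff[OF \<sigma>]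
          invariant_multisets_def not_less)
  next
    fix x assume "x \<in> ?L"
    then have x: "x \<in> carrier_vec n" "\<forall>i<n. x $ i \<in> \<int> \<and> 0 \<le> x $ i \<and> x $ i \<le> real d"
        "(\<Sum>i<n. x $ i) = 2 * real d" "\<forall>j<n. x $ shift_perm n \<sigma> j = x $ j"
      by (auto simp: invariants_def mem_dilate_lattice_points[OF d] perm_mat_fixes_iff[OF \<sigma>])
    define f where "f i = (if i < n then nat \<lfloor>x $ i\<rfloor> else 0)" for i
    have f: "real (f i) = x $ i" if "i < n" for i
      using x(2) that by (auto simp: f_def elim!: Ints_cases)
    have "real (\<Sum>i<n. f i) = 2 * real d"
      using x(3) f by simp
    then have "(\<Sum>i<n. f i) = 2 * d"
      by linarith
    moreover have "f i \<le> d" if "i < n" for i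
      using f[OF that] x(2) that by (metis of_nat_le_iff)
    moreover have "f (shift_perm n \<sigma> i) = f i" if "i < n" for i
      using s[OF that] that x(4) by (simp add: f_def)
    ultimately have "f \<in> ?R"
      by (auto simp: invariant_multisets_def f_def not_less)
    moreover have "x = ?v f"
      using x(1) f by (intro eq_vecI) auto
    ultimately show "x \<in> ?v ` ?R" by blast
  qed
  then show ?thesis
    by (rule bij_betw_same_card[symmetric])
qed

text \<open>
  For \<open>d = 0\<close> the correction term vanishes because it is stated as a coefficient of
  \<open>t P(t)\<close>, so the formula also covers the separately defined \<open>\<chi>\<^sub>0\<close>.
\<close>

lemma ehrhart_char_eq:
  assumes \<sigma>: "\<sigma> permutes {1..n}"
  shows "ehrhart_char n d \<sigma> =
    fps_nth (multiset_series {..<n} (shift_perm n \<sigma>)) (2 * d) -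
    of_nat (card {i \<in> {..<n}. shift_perm n \<sigma> i = i}) *
      fps_nth (fps_X * multiset_series {..<n} (shift_perm n \<sigma>)) d"
proof (cases "d = 0")
  case True
  have "invariant_multisets {..<n} (shift_perm n \<sigma>) 0 = {\<lambda>_. 0}"
    by (auto simp: invariant_multisets_def)
  with True show ?thesis
    by (simp add: ehrhart_char_def multiset_series_def)
next
  case False
  then have d: "d \<ge> 1" by simp
  let ?M = "invariant_multisets {..<n} (shift_perm n \<sigma>)"
  let ?large = "\<lambda>f. \<exists>x\<in>{..<n}. d < f x"
  have "card (?M (2 * d)) =
      card ({f \<in> ?M (2 * d). \<not> ?large f} \<union> {f \<in> ?M (2 * d). ?large f})"
    by (rule arg_cong[where f = card]) blast
  also have "\<dots> = card {f \<in> ?M (2 * d). \<not> ?large f} + card {f \<in> ?M (2 * d). ?large f}"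
    by (rule card_Un_disjoint) (auto simp: finite_invariant_multisets)
  finally have "card (?M (2 * d)) =
      card (invariants (dilate_lattice_points n d) (\<lambda>\<tau> x. perm_mat n \<tau> *\<^sub>v x) \<sigma>) +
      card {i \<in> {..<n}. shift_perm n \<sigma> i = i} * card (?M (d - 1))"
    using card_fixed_lattice_points[OF \<sigma> d]
      card_invariant_multisets_large_entry[OF _ shift_perm_permutes[OF \<sigma>] d] by simp
  then have "complex_of_nat (card (?M (2 * d))) =
      ehrhart_char n d \<sigma> +
      of_nat (card {i \<in> {..<n}. shift_perm n \<sigma> i = i}) * of_nat (card (?M (d - 1)))"
    using False by (simp add: ehrhart_char_def)
  then show ?thesis
    using False by (simp add: multiset_series_def)
qed


section \<open>The coefficients of the equivariant series\<close>

definition fixed_subsets :: "nat \<Rightarrow> nat \<Rightarrow> (nat \<Rightarrow> nat) \<Rightarrow> nat set set" where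
  "fixed_subsets n k \<sigma> = {S \<in> invariant_subsets {1..n} \<sigma>. card S = k}"

lemma card_fixed_subsets:
  assumes \<sigma>: "\<sigma> permutes {1..n}"
  shows "card {S \<in> invariant_subsets {..<n} (shift_perm n \<sigma>). card S = k} = card (fixed_subsets n k \<sigma>)"
proof (rule bij_betw_same_card)
  have eq: "\<sigma> ` Suc ` S = Suc ` shift_perm n \<sigma> ` S" if "S \<subseteq> {..<n}" for S
    unfolding image_image using that Suc_shift_perm[OF \<sigma>] by (intro image_cong) auto
  have inv: "S \<in> invariant_subsets {..<n} (shift_perm n \<sigma>) \<longleftrightarrow>
      Suc ` S \<in> invariant_subsets {1..n} \<sigma>" if "S \<subseteq> {..<n}" for S
    using that eq[OF that] by (auto simp: invariant_subsets_def inj_image_eq_iff)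
  have "image Suc ` {S \<in> invariant_subsets {..<n} (shift_perm n \<sigma>). card S = k} =
      fixed_subsets n k \<sigma>"
  proof (intro equalityI subsetI)
    fix T assume "T \<in> image Suc ` {S \<in> invariant_subsets {..<n} (shift_perm n \<sigma>). card S = k}"
    then obtain S where S: "S \<in> invariant_subsets {..<n} (shift_perm n \<sigma>)" "card S = k" "T = Suc ` S"
      by blast
    moreover from S(1) have "S \<subseteq> {..<n}"
      by (simp add: invariant_subsets_def)
    ultimately show "T \<in> fixed_subsets n k \<sigma>"
      using inv by (simp add: fixed_subsets_def card_image)
  next
    fix T assume T: "T \<in> fixed_subsets n k \<sigma>"
    then have "T \<subseteq> Suc ` {..<n}"
      by (simp add: fixed_subsets_def invariant_subsets_def image_Suc_lessThan)
    then obtain S where S: "S \<subseteq> {..<n}" "T = Suc ` S"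
      by (rule subset_imageE)
    then show "T \<in> image Suc ` {S \<in> invariant_subsets {..<n} (shift_perm n \<sigma>). card S = k}"
      using T inv[OF S(1)] by (auto simp: fixed_subsets_def card_image)
  qed
  then show "bij_betw (image Suc) {S \<in> invariant_subsets {..<n} (shift_perm n \<sigma>). card S = k}
      (fixed_subsets n k \<sigma>)"
    by (auto simp: bij_betw_def inj_on_def inj_image_eq_iff)
qed

lemma card_fixed_points:
  "card {i \<in> {..<n}. q i = i} = card {S \<in> invariant_subsets {..<n} q. card S = 1}"
proof (rule bij_betw_same_card)
  show "bij_betw (\<lambda>i. {i}) {i \<in> {..<n}. q i = i} {S \<in> invariant_subsets {..<n} q. card S = 1}"
    by (auto simp: bij_betw_def invariant_subsets_def card_1_singleton_iff image_iff)
qed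

text \<open>
  Multiplying the series of \<open>h\<^bsub>2d\<^esub> - e\<^sub>1 h\<^bsub>d-1\<^esub>\<close> by \<open>D = 1 / P\<close> turns the second term into
  \<open>e\<^sub>1 t\<close>, which only affects the coefficient for \<open>m = 1\<close>.
\<close>

lemma hstar_coeff_eq:
  assumes \<sigma>: "\<sigma> permutes {1..n}"
  shows "hstar_coeff n m \<sigma> = of_nat (card (fixed_subsets n (2 * m) \<sigma>)) -
           (if m = 1 then of_nat (card (fixed_subsets n 1 \<sigma>)) else 0)"
proof -
  let ?q = "shift_perm n \<sigma>"
  let ?D = "signed_subset_series {..<n} ?q" and ?P = "multiset_series {..<n} ?q"
  let ?E = "Abs_fps (\<lambda>d. fps_nth ?P (2 * d))"
  define N :: complex where "N = of_nat (card {i \<in> {..<n}. ?q i = i})"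
  note q = shift_perm_permutes[OF \<sigma>]
  have "ehrhart_series n \<sigma> = ?E - fps_const N * (fps_X * ?P)"
    by (rule fps_ext) (simp add: ehrhart_series_def ehrhart_char_eq[OF \<sigma>] N_def)
  then have "hstar_series n \<sigma> = (?E - fps_const N * (fps_X * ?P)) * ?D"
    by (simp add: hstar_series_eq det_series_eq[OF \<sigma>])
  also have "\<dots> = ?D * ?E - fps_const N * fps_X * (?D * ?P)"
    by (simp add: right_diff_distrib mult_ac)
  also have "?D * ?P = 1"
    using q by (intro signed_subset_series_times_multiset_series) auto
  finally have "hstar_coeff n m \<sigma> = fps_nth (?D * ?E) m - (if m = 1 then N else 0)"
    by (simp add: hstar_coeff_def fps_X_nth)
  also have "fps_nth (?D * ?E) m = of_nat (card (fixed_subsets n (2 * m) \<sigma>))"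
    using signed_subset_series_times_even_part[OF q] card_fixed_subsets[OF \<sigma>] by simp
  also have "N = of_nat (card (fixed_subsets n 1 \<sigma>))"
    unfolding N_def card_fixed_points card_fixed_subsets[OF \<sigma>] ..
  finally show ?thesis .
qed


section \<open>The action on subsets of fixed size\<close>

definition k_subsets :: "nat \<Rightarrow> nat \<Rightarrow> nat set set" where
  "k_subsets n k = {S. S \<subseteq> {1..n} \<and> card S = k}"

definition subset_action :: "nat \<Rightarrow> nat \<Rightarrow> (nat \<Rightarrow> nat) \<Rightarrow> nat set \<Rightarrow> nat set" where
  "subset_action n k \<sigma> = (\<lambda>S\<in>k_subsets n k. \<sigma> ` S)"

lemma image_k_subsets:
  assumes "\<sigma> permutes {1..n}" "S \<in> k_subsets n k"
  shows "\<sigma> ` S \<in> k_subsets n k"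
  using assms(2) image_mono[of S "{1..n}" \<sigma>] permutes_image[OF assms(1)]
  by (simp add: k_subsets_def card_image permutes_inj_on[OF assms(1)])

lemma invariants_subset_action: "invariants (k_subsets n k) (subset_action n k) \<sigma> = fixed_subsets n k \<sigma>"
  by (auto simp: invariants_def subset_action_def fixed_subsets_def invariant_subsets_def k_subsets_def)

lemma group_action_subset_action:
  "group_action (sym_group n) (k_subsets n k) (subset_action n k)"
proof -
  have Bij: "subset_action n k \<sigma> \<in> Bij (k_subsets n k)" if \<sigma>: "\<sigma> permutes {1..n}" for \<sigma>
  proof -
    have "bij_betw (image \<sigma>) (k_subsets n k) (k_subsets n k)"
      by (rule bij_betw_byWitness[where f' = "image (inv' \<sigma>)"])
        (auto simp: image_image permutes_inverses[OF \<sigma>]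
          intro: image_k_subsets[OF \<sigma>] image_k_subsets[OF permutes_inv[OF \<sigma>]])
    then have "bij_betw (subset_action n k \<sigma>) (k_subsets n k) (k_subsets n k)"
      by (rule iffD1[OF bij_betw_cong, rotated]) (simp add: subset_action_def)
    then show ?thesis by (simp add: Bij_def subset_action_def)
  qed
  have "subset_action n k \<in> hom (sym_group n) (BijGroup (k_subsets n k))"
  proof (rule homI)
    fix \<sigma> \<tau> assume "\<sigma> \<in> carrier (sym_group n)" "\<tau> \<in> carrier (sym_group n)"
    then have *: "\<sigma> permutes {1..n}" "\<tau> permutes {1..n}"
      by (simp_all add: sym_group_carrier)
    have "subset_action n k (\<sigma> \<circ> \<tau>) = compose (k_subsets n k) (subset_action n k \<sigma>) (subset_action n k \<tau>)"
      using image_k_subsets[OF *(2)] by (auto simp: compose_def subset_action_def fun_eq_iff)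
    then show "subset_action n k (\<sigma> \<otimes>\<^bsub>sym_group n\<^esub> \<tau>) =
        subset_action n k \<sigma> \<otimes>\<^bsub>BijGroup (k_subsets n k)\<^esub> subset_action n k \<tau>"
      using Bij * by (simp add: BijGroup_def sym_group_mult)
  qed (use Bij in \<open>simp add: BijGroup_def sym_group_carrier\<close>)
  then show ?thesis
    using sym_group_is_group
    by (simp add: group_action_def group_hom_def group_hom_axioms_def group_BijGroup)
qed

text \<open>Bijections between two subsets of equal size and between their complements combine to a permutation.\<close>

lemma subset_action_transitive:
  assumes S: "S \<in> k_subsets n k" and T: "T \<in> k_subsets n k"
  shows "\<exists>\<sigma>\<in>carrier (sym_group n). subset_action n k \<sigma> S = T"
proof -
  have fin: "finite S" "finite T"
    using S T finite_subset[of _ "{1..n}"] by (auto simp: k_subsets_def)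
  obtain f where f: "bij_betw f S T"
    using S T fin finite_same_card_bij[of S T] by (auto simp: k_subsets_def)
  have "card ({1..n} - S) = card ({1..n} - T)"
    using S T fin by (simp add: k_subsets_def card_Diff_subset)
  then obtain g where g: "bij_betw g ({1..n} - S) ({1..n} - T)"
    using finite_same_card_bij[of "{1..n} - S" "{1..n} - T"] by auto
  define h where "h x = (if x \<in> S then f x else g x)" for x
  have "bij_betw h (S \<union> ({1..n} - S)) (T \<union> ({1..n} - T))"
    unfolding h_def using f g by (rule bij_betw_disjoint_Un) auto
  then have h: "bij_betw h {1..n} {1..n}"
    using S T by (simp add: k_subsets_def Un_absorb1)
  define \<sigma> where "\<sigma> = restrict_id h {1..n}"
  have "\<sigma> permutes {1..n}"
    unfolding \<sigma>_def using h by (rule permutes_restrict_id)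
  moreover have "\<sigma> ` S = f ` S"
    using S by (intro image_cong) (auto simp: \<sigma>_def h_def k_subsets_def)
  then have "\<sigma> ` S = T"
    using f by (simp add: bij_betw_def)
  ultimately show ?thesis
    using S by (auto simp: sym_group_carrier subset_action_def)
qed

section \<open>Multiplicity of the trivial character\<close>

text \<open>Burnside's orbit counting lemma, read as a statement about characters.\<close>

lemma character_inner_permutation_character_trivial:
  assumes "group_action G X \<phi>" "finite (carrier G)" "finite X"
  shows "character_inner G (\<lambda>g. of_nat (card (invariants X \<phi> g))) trivial_character =
         of_nat (card (orbits G X \<phi>))"
proof -
  interpret group_action G X \<phi> by fact
  interpret group_hom G "BijGroup X" \<phi> by (rule group_hom)
  have "card (carrier G) \<noteq> 0"
    using assms(2) G.one_closed by auto
  moreover have "(\<Sum>g\<in>carrier G. complex_of_nat (card (invariants X \<phi> g))) =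
      of_nat (card (orbits G X \<phi>)) * of_nat (card (carrier G))"
    using arg_cong[OF burnside[OF assms(2,3)], of complex_of_nat] by (simp add: Coset.order_def)
  ultimately show ?thesis
    by (simp add: character_inner_def trivial_character_def)
qed

lemma card_orbits_subset_action:
  assumes "k \<le> n"
  shows "card (orbits (sym_group n) (k_subsets n k) (subset_action n k)) = 1"
proof -
  interpret group_action "sym_group n" "k_subsets n k" "subset_action n k"
    by (rule group_action_subset_action)
  have "orbit (sym_group n) (subset_action n k) S = k_subsets n k" if "S \<in> k_subsets n k" for S
    using that subset_action_transitive[OF that] element_image[OF _ that]
    unfolding orbit_def by blast
  moreover have "{1..k} \<in> k_subsets n k"
    using assms by (simp add: k_subsets_def)
  ultimately have "orbits (sym_group n) (k_subsets n k) (subset_action n k) = {k_subsets n k}"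
    unfolding orbits_def by blast
  then show ?thesis by simp
qed

lemma finite_k_subsets: "finite (k_subsets n k)"
  by (rule finite_subset[of _ "Pow {1..n}"]) (auto simp: k_subsets_def)

lemma finite_sym_group: "finite (carrier (sym_group n))"
  by (simp add: sym_group_def finite_permutations)

lemma character_inner_hstar_coeff_1:
  assumes "n \<ge> 2"
  shows "character_inner (sym_group n) (hstar_coeff n 1) trivial_character = 0"
proof -
  let ?c = "\<lambda>k. character_inner (sym_group n) (\<lambda>\<sigma>. of_nat (card (fixed_subsets n k \<sigma>))) trivial_character"
  have one: "?c k = 1" if "k \<le> n" for k
    using character_inner_permutation_character_trivial[OF group_action_subset_action
        finite_sym_group finite_k_subsets, of n k] card_orbits_subset_action[OF that]
    by (simp add: invariants_subset_action)
  have "character_inner (sym_group n) (hstar_coeff n 1) trivial_character = ?c 2 - ?c 1"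
    by (simp add: character_inner_def hstar_coeff_eq sym_group_carrier left_diff_distrib
        sum_subtractf diff_divide_distrib)
  then show ?thesis
    using assms by (simp add: one)
qed

text \<open>No trivial constituent means no orbits, so the set acted upon is empty.\<close>

lemma permutation_character_trivial_multiplicity_zero:
  assumes ch: "is_permutation_character G f" and fin: "finite (carrier G)"
    and zero: "character_inner G f trivial_character = 0" and g: "g \<in> carrier G"
  shows "f g = 0"
proof -
  obtain X :: "nat set" and \<phi> where X: "finite X" "group_action G X \<phi>"
      and f: "\<And>g. g \<in> carrier G \<Longrightarrow> f g = of_nat (card (invariants X \<phi> g))"
    using ch by (auto simp: is_permutation_character_def)
  have "character_inner G f trivial_character = of_nat (card (orbits G X \<phi>))"
    using character_inner_permutation_character_trivial[OF X(2) fin X(1)] f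
    by (simp add: character_inner_def)
  with zero have "card (orbits G X \<phi>) = 0" by simp
  moreover have "finite (orbits G X \<phi>)"
    using X(1) by (simp add: orbits_def)
  ultimately have "X = {}"
    by (auto simp: orbits_def)
  then show ?thesis
    using f[OF g] by (simp add: invariants_def)
qed

lemma hstar_coeff_1_id:
  "hstar_coeff n 1 id = of_nat (n choose 2) - of_nat n"
proof -
  have "fixed_subsets n k id = {S. S \<subseteq> {1..n} \<and> card S = k}" for k
    by (auto simp: fixed_subsets_def invariant_subsets_def)
  then show ?thesis
    by (simp add: hstar_coeff_eq permutes_id n_subsets)
qed

theorem corollary5p5:
  fixes n :: nat
  assumes "n \<ge> 4"
  shows "(\<forall>m \<le> n div 2.
            is_permutation_character (sym_group n) (hstar_coeff n m) \<longleftrightarrow> m \<noteq> 1) \<and>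
         character_inner (sym_group n) (hstar_coeff n 1) trivial_character = 0"
proof -
  have trivial: "character_inner (sym_group n) (hstar_coeff n 1) trivial_character = 0"
    using assms by (intro character_inner_hstar_coeff_1) simp
  have "is_permutation_character (sym_group n) (hstar_coeff n m)" if "m \<noteq> 1" for m
    using finite_k_subsets group_action_subset_action
  proof (rule is_permutation_characterI)
    fix \<sigma> assume "\<sigma> \<in> carrier (sym_group n)"
    then show "hstar_coeff n m \<sigma> =
        of_nat (card (invariants (k_subsets n (2 * m)) (subset_action n (2 * m)) \<sigma>))"
      using that by (simp add: sym_group_carrier hstar_coeff_eq invariants_subset_action)
  qed
  moreover have "\<not> is_permutation_character (sym_group n) (hstar_coeff n 1)"
  proof
    assume "is_permutation_character (sym_group n) (hstar_coeff n 1)"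
    then have "hstar_coeff n 1 id = 0"
      using finite_sym_group trivial
      by (rule permutation_character_trivial_multiplicity_zero) (simp add: sym_group_carrier permutes_id)
    then have "n choose 2 = n"
      unfolding hstar_coeff_1_id by simp
    moreover have "2 * (n choose 2) = n * (n - 1)"
      using times_binomial_minus1_eq[of 2 n] by simp
    moreover have "n * 3 \<le> n * (n - 1)"
      using assms by (intro mult_le_mono2) simp
    ultimately show False
      using assms by linarith
  qed
  ultimately show ?thesis
    using trivial by auto
qed

end
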